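(* Let $q^{\pm1},q^{\pm\omega_1},q^{\pm\omega_2}$ be such that $\delta=[2]$, $s_1=\frac{[\omega_1]}{[\omega_1+1]}$, $s_2=\frac{[\omega_2]}{[\omega_2+1]}$. Then there is a surjective algebra homomorphism $\pi$ from the affine Hecke algebra of type C to the two-boundary Temperley-Lieb algebra with parameters $\delta,s_1,s_2$, given by $$\pi(g_i^{\pm1})=e_i-q^{\mp1}\quad(1\le i\le N-1),$$ $$\pi(g_0^{\pm1})=q^{\pm\omega_1}-\big(q^{\pm(1+\omega_1)}-q^{\mp(1+\omega_1)}\big)e_0,\qquad \pi(g_N^{\pm1})=q^{\pm\omega_2}-\big(q^{\pm(1+\omega_2)}-q^{\mp(1+\omega_2)}\big)e_N.$$
   Context: Let $N\ge2$. Both algebras are taken over $\mathbb C$, with $q,q^{\omega_1},q^{\omega_2}$ nonzero complex numbers, $[n]=\frac{q^n-q^{-n}}{q-q^{-1}}$ (so e.g. $[\omega_1+1]=\frac{q\,q^{\omega_1}-q^{-1}q^{-\omega_1}}{q-q^{-1}}$), with $q^2\ne1$ and $[\omega_1+1],[\omega_2+1]\neq0$. Affine Hecke algebra of type C: unital algebra with generators $g_0,g_1,\dots,g_N$ and relations $g_ig_{i+1}g_i=g_{i+1}g_ig_{i+1}$ ($1\le i\le N-2$); $g_0g_1g_0g_1=g_1g_0g_1g_0$; $g_Ng_{N-1}g_Ng_{N-1}=g_{N-1}g_Ng_{N-1}g_N$; $g_ig_j=g_jg_i$ for $|i-j|>1$ ($0\le i,j\le N$); $(g_i-q)(g_i+q^{-1})=0$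 ($1\le i\le N-1$); $(g_0-q^{\omega_1})(g_0-q^{-\omega_1})=0$; $(g_N-q^{\omega_2})(g_N-q^{-\omega_2})=0$. Two-boundary Temperley-Lieb (2BTL) algebra: unital algebra with generators $e_0,\dots,e_N$ and relations $e_i^2=\delta e_i$, $e_ie_{i\pm1}e_i=e_i$ for $1\le i\le N-1$ (with $i\pm1\in\{0,\dots,N\}$), $e_0^2=s_1e_0$, $e_N^2=s_2e_N$, $e_ie_j=e_je_i$ for $|i-j|>1$. *)

theory Defs
  imports
    "HOL-Algebra.Algebraic_Closure_Type"
    "HOL-Algebra.Module"
    "HOL-Algebra.QuotRing"
    "HOL-Library.Poly_Mapping"
    Complex_Main
begin

section \<open>Associative algebras and presentations\<close>

text \<open>
  The locale \<^locale>\<open>algebra\<close> of the library only covers commutative algebras; we need unital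
  associative algebras that are not necessarily commutative.
\<close>

locale assoc_algebra = module R A + ring A for R and A (structure) +
  assumes smult_mult_left:
      "\<lbrakk>c \<in> carrier R; x \<in> carrier A; y \<in> carrier A\<rbrakk> \<Longrightarrow> (c \<odot> x) \<otimes> y = c \<odot> (x \<otimes> y)"
    and smult_mult_right:
      "\<lbrakk>c \<in> carrier R; x \<in> carrier A; y \<in> carrier A\<rbrakk> \<Longrightarrow> x \<otimes> (c \<odot> y) = c \<odot> (x \<otimes> y)"

definition algebra_hom ::
    "('k, 'r) ring_scheme \<Rightarrow> ('k, 'a, 'm) module_scheme \<Rightarrow> ('k, 'b, 'n) module_scheme \<Rightarrow> ('a \<Rightarrow> 'b) set"
  where "algebra_hom R A B = {h. assoc_algebra R A \<and> assoc_algebra R B \<and> h \<in> ring_hom A B \<and>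
     (\<forall>c\<in>carrier R. \<forall>x\<in>carrier A. h (c \<odot>\<^bsub>A\<^esub> x) = c \<odot>\<^bsub>B\<^esub> h x)}"

abbreviation complex_field :: "complex ring"
  where "complex_field \<equiv> ring_of_type_algebra"

text \<open>
  Words form a monoid under concatenation, written additively here because the convolution product
  on \<^typ>\<open>'a \<Rightarrow>\<^sub>0 'b\<close> expects an additive monoid of exponents. The monoid is not commutative, so
  that \<open>'x free_word \<Rightarrow>\<^sub>0 complex\<close> is the ring of noncommutative polynomials in
  indeterminates of type \<^typ>\<open>'x\<close>.
\<close>

datatype 'a free_word = Word (letters: "'a list")

instantiation free_word :: (type) monoid_add
begin

definition zero_free_word :: "'a free_word"
  where "0 = Word []"

definition plus_free_word :: "'a free_word \<Rightarrow> 'a free_word \<Rightarrow> 'a free_word"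
  where "u + v = Word (letters u @ letters v)"

instance
  by standard (simp_all add: zero_free_word_def plus_free_word_def)

end

type_synonym 'x nc_poly = "'x free_word \<Rightarrow>\<^sub>0 complex"

definition nc_const :: "complex \<Rightarrow> 'x nc_poly"
  where "nc_const c = Poly_Mapping.single 0 c"

definition nc_var :: "'x \<Rightarrow> 'x nc_poly"
  where "nc_var x = Poly_Mapping.single (Word [x]) 1"

definition free_algebra :: "'x set \<Rightarrow> (complex, 'x nc_poly) module"
  where "free_algebra S =
    \<lparr>carrier = {p. \<forall>w\<in>Poly_Mapping.keys p. set (letters w) \<subseteq> S},
     monoid.mult = (*), one = 1, ring.zero = 0, add = (+),
     module.smult = (\<lambda>c p. nc_const c * p)\<rparr>"

text \<open>
  The elements of \<open>Rels\<close> are noncommutative polynomials that are set equal to zero; the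
  library's ideals are two-sided. The scalar multiplication of cosets follows the pattern of
  \<^const>\<open>rcoset_mult\<close>.
\<close>

definition presented_algebra :: "'x set \<Rightarrow> 'x nc_poly set \<Rightarrow> (complex, 'x nc_poly set) module"
  where "presented_algebra S Rels =
    (let F = free_algebra S; I = Idl\<^bsub>F\<^esub> Rels
     in ring.extend (F Quot I)
          (module.fields (\<lambda>c A. \<Union>a\<in>A. I +>\<^bsub>F\<^esub> (c \<odot>\<^bsub>F\<^esub> a))))"

definition presented_gen :: "'x set \<Rightarrow> 'x nc_poly set \<Rightarrow> 'x \<Rightarrow> 'x nc_poly set"
  where "presented_gen S Rels x = (Idl\<^bsub>free_algebra S\<^esub> Rels) +>\<^bsub>free_algebra S\<^esub> nc_var x"


section \<open>The two algebras\<close>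

text \<open>
  The parameters \<open>qw1\<close> and \<open>qw2\<close> stand for \<open>q\<close> to the power \<open>\<omega>\<^sub>1\<close> and \<open>\<omega>\<^sub>2\<close>, and are
  arbitrary nonzero complex numbers in their own right; no logarithm is chosen.
\<close>

definition hecke_C_rels :: "nat \<Rightarrow> complex \<Rightarrow> complex \<Rightarrow> complex \<Rightarrow> nat nc_poly set"
  where "hecke_C_rels N q qw1 qw2 =
    (let g = nc_var in
      {g i * g (i + 1) * g i - g (i + 1) * g i * g (i + 1) | i. 1 \<le> i \<and> i + 2 \<le> N}
    \<union> {g 0 * g 1 * g 0 * g 1 - g 1 * g 0 * g 1 * g 0}
    \<union> {g N * g (N - 1) * g N * g (N - 1) - g (N - 1) * g N * g (N - 1) * g N}
    \<union> {g i * g j - g j * g i | i j. i \<le> N \<and> j \<le> N \<and> \<bar>int i - int j\<bar> > 1}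
    \<union> {(g i - nc_const q) * (g i + nc_const (inverse q)) | i. 1 \<le> i \<and> i + 1 \<le> N}
    \<union> {(g 0 - nc_const qw1) * (g 0 - nc_const (inverse qw1))}
    \<union> {(g N - nc_const qw2) * (g N - nc_const (inverse qw2))})"

definition hecke_C :: "nat \<Rightarrow> complex \<Rightarrow> complex \<Rightarrow> complex \<Rightarrow> (complex, nat nc_poly set) module"
  where "hecke_C N q qw1 qw2 = presented_algebra {0..N} (hecke_C_rels N q qw1 qw2)"

definition hecke_C_gen :: "nat \<Rightarrow> complex \<Rightarrow> complex \<Rightarrow> complex \<Rightarrow> nat \<Rightarrow> nat nc_poly set"
  where "hecke_C_gen N q qw1 qw2 = presented_gen {0..N} (hecke_C_rels N q qw1 qw2)"

definition two_boundary_TL_rels :: "nat \<Rightarrow> complex \<Rightarrow> complex \<Rightarrow> complex \<Rightarrow> nat nc_poly set"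
  where "two_boundary_TL_rels N \<delta> s1 s2 =
    (let e = nc_var in
      {e i * e i - nc_const \<delta> * e i | i. 1 \<le> i \<and> i + 1 \<le> N}
    \<union> {e i * e (i + 1) * e i - e i | i. 1 \<le> i \<and> i + 1 \<le> N}
    \<union> {e i * e (i - 1) * e i - e i | i. 1 \<le> i \<and> i + 1 \<le> N}
    \<union> {e 0 * e 0 - nc_const s1 * e 0}
    \<union> {e N * e N - nc_const s2 * e N}
    \<union> {e i * e j - e j * e i | i j. i \<le> N \<and> j \<le> N \<and> \<bar>int i - int j\<bar> > 1})"

definition two_boundary_TL ::
    "nat \<Rightarrow> complex \<Rightarrow> complex \<Rightarrow> complex \<Rightarrow> (complex, nat nc_poly set) module"
  where "two_boundary_TL N \<delta> s1 s2 = presented_algebra {0..N} (two_boundary_TL_rels N \<delta> s1 s2)"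

definition two_boundary_TL_gen ::
    "nat \<Rightarrow> complex \<Rightarrow> complex \<Rightarrow> complex \<Rightarrow> nat \<Rightarrow> nat nc_poly set"
  where "two_boundary_TL_gen N \<delta> s1 s2 = presented_gen {0..N} (two_boundary_TL_rels N \<delta> s1 s2)"

text \<open>
  The q-number \<open>[n]\<close> as a function of \<open>x\<close>, the value of \<open>q\<close> to the power \<open>n\<close>; thus \<open>[2]\<close> is
  \<open>qnum q (q^2)\<close> and \<open>[\<omega>\<^sub>1 + 1]\<close> is \<open>qnum q (q * qw1)\<close>.
\<close>

definition qnum :: "complex \<Rightarrow> complex \<Rightarrow> complex"
  where "qnum q x = (x - inverse x) / (q - inverse q)"

end

theory Submission
  imports Defs
begin

text \<open>
  Each proposed image of a Hecke generator is an affine combination \<open>a + b e\<^sub>i\<close> of a single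
  Temperley-Lieb generator with \<open>b \<noteq> 0\<close>. Substituting these combinations into a Hecke relation
  and expanding gives an element of the ideal of Temperley-Lieb relations plus a multiple of \<open>e\<^sub>i\<close>,
  \<open>e\<^sub>i - e\<^sub>j\<close> or \<open>e\<^sub>i e\<^sub>j - e\<^sub>j e\<^sub>i\<close> whose coefficient vanishes for the given parameters; so the substitution
  descends to the quotients. It is surjective already on free algebras, because the affine
  substitution is invertible there. A quadratic relation \<open>(x - u) (x - v) = 0\<close> makes \<open>x\<close> invertible
  with inverse \<open>(u + v - x) / (u v)\<close>, which yields the images of the inverses.
\<close>

section \<open>Noncommutative polynomials\<close>

lemma sum_single_lookup:
  "(\<Sum>w\<in>Poly_Mapping.keys p. Poly_Mapping.single w (Poly_Mapping.lookup p w)) = p"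
  by (rule poly_mapping_eqI)
    (auto simp: lookup_sum lookup_single when_def sum.delta in_keys_iff)

text \<open>Zero is the monomial with coefficient 0, so it needs no case of its own. This reduces
  additive identities to monomials.\<close>

lemma poly_mapping_single_add_induct [case_names single add]:
  fixes p :: "'a \<Rightarrow>\<^sub>0 'b::comm_monoid_add"
  assumes "\<And>w c. P (Poly_Mapping.single w c)" and "\<And>p q. P p \<Longrightarrow> P q \<Longrightarrow> P (p + q)"
  shows "P p"
proof -
  have "P 0"
    using assms(1)[of undefined 0] by simp
  then have "P (\<Sum>w\<in>A. Poly_Mapping.single w (Poly_Mapping.lookup p w))" for A
    by (induction A rule: infinite_finite_induct) (auto intro: assms)
  then show ?thesis
    by (metis sum_single_lookup)
qed

lemma nc_const_0 [simp]: "nc_const 0 = 0"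
  and nc_const_1 [simp]: "nc_const 1 = 1"
  and nc_const_add: "nc_const (a + b) = nc_const a + nc_const b"
  and nc_const_diff: "nc_const (a - b) = nc_const a - nc_const b"
  and nc_const_uminus: "nc_const (- a) = - nc_const a"
  and nc_const_mult: "nc_const (a * b) = nc_const a * nc_const b"
  by (simp_all add: nc_const_def single_add single_diff single_uminus mult_single)

text \<open>Scalars sit on the empty word, the unit of concatenation, so they are central although
  words do not commute. Later uses fix \<open>p\<close> as an indeterminate or a product, so that
  scalars move to the left.\<close>

lemma nc_const_commute: "p * nc_const c = nc_const c * p"
  by (induction p rule: poly_mapping_single_add_induct)
    (simp_all add: nc_const_def mult_single algebra_simps)

lemma nc_const_left_commute: "p * (nc_const c * r) = nc_const c * (p * r)"
  by (metis mult.assoc nc_const_commute)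

lemma nc_const_mult_assoc: "nc_const a * (nc_const b * r) = nc_const (a * b) * r"
  by (simp add: nc_const_mult mult.assoc)

text \<open>Products of scalars are merged and sums of scalars split, so that both sides of an
  identity become sums of words with monomial coefficients.\<close>

lemmas nc_expand =
  nc_const_mult_assoc nc_const_mult[symmetric] nc_const_add nc_const_diff nc_const_uminus

lemma single_Word: "Poly_Mapping.single (Word ws) c = nc_const c * prod_list (map nc_var ws)"
proof (induction ws)
  case Nil
  then show ?case
    by (simp add: nc_const_def zero_free_word_def)
next
  case (Cons x ws)
  have "Poly_Mapping.single (Word (x # ws)) c = nc_var x * Poly_Mapping.single (Word ws) c"
    by (simp add: nc_var_def mult_single plus_free_word_def)
  then show ?case
    by (simp add: Cons nc_const_left_commute)
qed

text \<open>The algebra homomorphism extending \<open>f\<close>, from the universal property of the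
  free algebra. Generating sets enter only through the closure lemmas.\<close>

definition nc_subst :: "('x \<Rightarrow> 'y nc_poly) \<Rightarrow> 'x nc_poly \<Rightarrow> 'y nc_poly"
  where "nc_subst f p =
    (\<Sum>w\<in>Poly_Mapping.keys p. nc_const (Poly_Mapping.lookup p w) * prod_list (map f (letters w)))"

lemma nc_subst_single:
  "nc_subst f (Poly_Mapping.single w c) = nc_const c * prod_list (map f (letters w))"
  by (simp add: nc_subst_def)

lemma nc_subst_const [simp]: "nc_subst f (nc_const c) = nc_const c"
  by (simp add: nc_subst_single nc_const_def zero_free_word_def)

lemma nc_subst_var [simp]: "nc_subst f (nc_var x) = f x"
  by (simp add: nc_var_def nc_subst_single)

lemma nc_subst_1 [simp]: "nc_subst f 1 = 1"
  using nc_subst_const[of f 1] by simp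

lemma nc_subst_add [simp]: "nc_subst f (p + r) = nc_subst f p + nc_subst f r"
  unfolding nc_subst_def
  by (rule setsum_keys_plus_distrib) (simp_all add: nc_const_add distrib_right)

lemma nc_subst_diff [simp]: "nc_subst f (p - r) = nc_subst f p - nc_subst f r"
  using nc_subst_add[of f "p - r" r] by (simp add: algebra_simps)

text \<open>Both sides are biadditive, so monomials suffice; there concatenation becomes
  multiplication and the scalars can be collected on the left.\<close>

lemma nc_subst_mult [simp]: "nc_subst f (p * r) = nc_subst f p * nc_subst f r"
proof (induction p rule: poly_mapping_single_add_induct)
  case (single u a)
  show ?case
  proof (induction r rule: poly_mapping_single_add_induct)
    case (single v b)
    show ?case
      by (simp add: mult_single nc_subst_single plus_free_word_def nc_const_mult mult.assoc
          nc_const_left_commute[of "prod_list _"])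
  qed (simp add: distrib_left)
qed (simp add: distrib_right)


section \<open>Free algebras and presented algebras\<close>

lemma free_algebra_simps [simp]:
  "p \<otimes>\<^bsub>free_algebra S\<^esub> r = p * r"
  "\<one>\<^bsub>free_algebra S\<^esub> = 1"
  "\<zero>\<^bsub>free_algebra S\<^esub> = 0"
  "p \<oplus>\<^bsub>free_algebra S\<^esub> r = p + r"
  "c \<odot>\<^bsub>free_algebra S\<^esub> p = nc_const c * p"
  by (simp_all add: free_algebra_def)

lemma carrier_free_algebra:
  "p \<in> carrier (free_algebra S) \<longleftrightarrow> (\<forall>w\<in>Poly_Mapping.keys p. set (letters w) \<subseteq> S)"
  by (simp add: free_algebra_def)

lemma free_algebra_const [simp]: "nc_const c \<in> carrier (free_algebra S)"
  by (auto simp: carrier_free_algebra nc_const_def zero_free_word_def split: if_splits)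

lemma free_algebra_var [simp]: "nc_var x \<in> carrier (free_algebra S) \<longleftrightarrow> x \<in> S"
  by (simp add: carrier_free_algebra nc_var_def)

lemma free_algebra_0 [simp]: "0 \<in> carrier (free_algebra S)"
  and free_algebra_1 [simp]: "1 \<in> carrier (free_algebra S)"
  using free_algebra_const[of 0 S] free_algebra_const[of 1 S] by simp_all

lemma free_algebra_add [simp]:
  "\<lbrakk>p \<in> carrier (free_algebra S); r \<in> carrier (free_algebra S)\<rbrakk> \<Longrightarrow> p + r \<in> carrier (free_algebra S)"
  unfolding carrier_free_algebra using Poly_Mapping.keys_add[of p r] by blast

lemma free_algebra_uminus [simp]:
  "p \<in> carrier (free_algebra S) \<Longrightarrow> - p \<in> carrier (free_algebra S)"
  by (simp add: carrier_free_algebra)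

lemma free_algebra_diff [simp]:
  "\<lbrakk>p \<in> carrier (free_algebra S); r \<in> carrier (free_algebra S)\<rbrakk> \<Longrightarrow> p - r \<in> carrier (free_algebra S)"
  using free_algebra_add[of p S "- r"] by simp

lemma free_algebra_mult [simp]:
  assumes "p \<in> carrier (free_algebra S)" "r \<in> carrier (free_algebra S)"
  shows "p * r \<in> carrier (free_algebra S)"
  unfolding carrier_free_algebra
proof
  fix w
  assume "w \<in> Poly_Mapping.keys (p * r)"
  then obtain u v where "w = u + v" "u \<in> Poly_Mapping.keys p" "v \<in> Poly_Mapping.keys r"
    using keys_mult[of p r] by blast
  then show "set (letters w) \<subseteq> S"
    using assms by (auto simp: carrier_free_algebra plus_free_word_def)
qed

lemma ring_free_algebra: "ring (free_algebra S)"
proof (rule ringI)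
  show "abelian_group (free_algebra S)"
  proof (rule abelian_groupI)
    fix p
    assume "p \<in> carrier (free_algebra S)"
    then show "\<exists>r\<in>carrier (free_algebra S). r \<oplus>\<^bsub>free_algebra S\<^esub> p = \<zero>\<^bsub>free_algebra S\<^esub>"
      by (intro bexI[of _ "- p"]) simp_all
  qed (simp_all add: algebra_simps)
  show "Group.monoid (free_algebra S)"
    by (rule monoidI) (simp_all add: mult.assoc)
qed (simp_all add: algebra_simps)

text \<open>An element is a finite sum of scalars times words over \<open>S\<close>, and each such
  word is a product of variables.\<close>

lemma free_algebra_induct [consumes 1, case_names const var add mult]:
  assumes "p \<in> carrier (free_algebra S)"
    and const: "\<And>c. P (nc_const c)"
    and var: "\<And>x. x \<in> S \<Longrightarrow> P (nc_var x)"
    and add: "\<And>p r. P p \<Longrightarrow> P r \<Longrightarrow> P (p + r)"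
    and mult: "\<And>p r. P p \<Longrightarrow> P r \<Longrightarrow> P (p * r)"
  shows "P p"
proof -
  have word: "P (prod_list (map nc_var ws))" if "set ws \<subseteq> S" for ws
    using that
  proof (induction ws)
    case Nil
    then show ?case using const[of 1] by simp
  qed (auto intro: var mult)
  have single: "P (Poly_Mapping.single w c)" if "set (letters w) \<subseteq> S" for w c
    using mult[OF const word[OF that], of c] by (cases w) (simp add: single_Word)
  \<comment> \<open>Restricting to subsets of the support keeps every word over \<open>S\<close>
    during the induction.\<close>
  have "P (\<Sum>w\<in>A. Poly_Mapping.single w (Poly_Mapping.lookup p w))"
    if "A \<subseteq> Poly_Mapping.keys p" for A
    using that assms(1) const[of 0]
    by (induction A rule: infinite_finite_induct)
      (auto simp: carrier_free_algebra intro!: add single)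
  from this[OF order_refl] show ?thesis
    by (simp add: sum_single_lookup)
qed

lemma nc_subst_closed:
  assumes "p \<in> carrier (free_algebra S)" and "\<And>x. x \<in> S \<Longrightarrow> f x \<in> carrier (free_algebra S')"
  shows "nc_subst f p \<in> carrier (free_algebra S')"
  using assms by (induction p rule: free_algebra_induct) simp_all

text \<open>A composite of substitutions is a homomorphism; fixing the generators, it fixes
  everything. This will give a right inverse and hence surjectivity.\<close>

lemma nc_subst_nc_subst_id:
  assumes "p \<in> carrier (free_algebra S)" and "\<And>x. x \<in> S \<Longrightarrow> nc_subst f (g x) = nc_var x"
  shows "nc_subst f (nc_subst g p) = p"
  using assms by (induction p rule: free_algebra_induct) simp_all

lemma nc_subst_ring_hom:
  assumes "\<And>x. x \<in> S \<Longrightarrow> f x \<in> carrier (free_algebra S')"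
  shows "nc_subst f \<in> ring_hom (free_algebra S) (free_algebra S')"
  by (rule ring_hom_memI) (simp_all add: nc_subst_closed assms)

section \<open>Quotients of free algebras by relations\<close>

locale presentation =
  fixes S :: "'x set" and Rels :: "'x nc_poly set"
  assumes Rels_closed: "Rels \<subseteq> carrier (free_algebra S)"
begin

abbreviation F where "F \<equiv> free_algebra S"
abbreviation I where "I \<equiv> Idl\<^bsub>F\<^esub> Rels"
abbreviation A where "A \<equiv> presented_algebra S Rels"
abbreviation cls where "cls p \<equiv> I +>\<^bsub>F\<^esub> p"

sublocale ideal I F
  by (rule ring.genideal_ideal[OF ring_free_algebra Rels_closed])

lemma minus_free_algebra [simp]: "\<lbrakk>p \<in> carrier F; r \<in> carrier F\<rbrakk> \<Longrightarrow> p \<ominus>\<^bsub>F\<^esub> r = p - r"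
  using minus_equality[of "- r" r] by (simp add: minus_eq)

lemma Rels_I: "r \<in> Rels \<Longrightarrow> r \<in> I"
  using genideal_self[OF Rels_closed] by blast

lemma I_mult: "\<lbrakk>u \<in> carrier F; p \<in> I\<rbrakk> \<Longrightarrow> u * p \<in> I" "\<lbrakk>u \<in> carrier F; p \<in> I\<rbrakk> \<Longrightarrow> p * u \<in> I"
  using I_l_closed I_r_closed by simp_all

lemma I_add: "\<lbrakk>p \<in> I; r \<in> I\<rbrakk> \<Longrightarrow> p + r \<in> I"
  using additive_subgroup.a_closed[OF is_additive_subgroup, of p r] by simp

lemma I_diff: "\<lbrakk>p \<in> I; r \<in> I\<rbrakk> \<Longrightarrow> p - r \<in> I"
  using I_add[of p "nc_const (- 1) * r"] I_mult(1)[of "nc_const (- 1)" r]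
  by (simp add: nc_const_uminus)

text \<open>Turns every equation between cosets into membership of a polynomial in the
  ideal.\<close>

lemma cls_eq_iff:
  assumes "p \<in> carrier F" "r \<in> carrier F"
  shows "cls p = cls r \<longleftrightarrow> p - r \<in> I"
proof -
  have "cls p = cls r \<longleftrightarrow> p \<in> cls r"
    using a_rcos_self[OF assms(1)] a_repr_independence'[OF _ assms(2), of p] by metis
  then show ?thesis
    using a_rcos_module_minus[OF ring_free_algebra assms(2,1)] assms by simp
qed

lemma carrier_presented: "carrier A = cls ` carrier F"
  by (auto simp: presented_algebra_def Let_def ring.defs module.defs FactRing_simps)

lemma cls_closed: "p \<in> carrier F \<Longrightarrow> cls p \<in> carrier A"
  by (simp add: carrier_presented)

lemma presented_one: "\<one>\<^bsub>A\<^esub> = cls 1"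
  by (simp add: presented_algebra_def Let_def ring.defs module.defs FactRing_def)

lemma presented_mult: "\<lbrakk>p \<in> carrier F; r \<in> carrier F\<rbrakk> \<Longrightarrow> cls p \<otimes>\<^bsub>A\<^esub> cls r = cls (p * r)"
  by (simp add: presented_algebra_def Let_def ring.defs module.defs FactRing_def rcoset_mult_add)

lemma presented_add: "\<lbrakk>p \<in> carrier F; r \<in> carrier F\<rbrakk> \<Longrightarrow> cls p \<oplus>\<^bsub>A\<^esub> cls r = cls (p + r)"
  by (simp add: presented_algebra_def Let_def ring.defs module.defs FactRing_def a_rcos_sum)

text \<open>Scalar multiplication and the induced maps are unions over the representatives of a
  coset; this reduces their well-definedness to independence of the representative.\<close>

lemma UN_cls_const:
  assumes "p \<in> carrier F" and "\<And>r. r \<in> cls p \<Longrightarrow> f r = f p"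
  shows "(\<Union>r\<in>cls p. f r) = f p"
  using assms a_rcos_self[of p] by blast

lemma mem_cls:
  assumes "p \<in> carrier F" "r \<in> cls p"
  shows "r \<in> carrier F" "r - p \<in> I"
proof -
  show "r \<in> carrier F"
    using assms a_r_coset_subset_G[OF a_subset] by blast
  then show "r - p \<in> I"
    using a_rcos_module_minus[OF ring_free_algebra, of p r] assms by simp
qed

lemma presented_smult:
  assumes "p \<in> carrier F"
  shows "c \<odot>\<^bsub>A\<^esub> cls p = cls (nc_const c * p)"
proof -
  have "c \<odot>\<^bsub>A\<^esub> cls p = (\<Union>r\<in>cls p. cls (nc_const c * r))"
    by (simp add: presented_algebra_def Let_def ring.defs module.defs)
  also have "\<dots> = cls (nc_const c * p)"
  proof (rule UN_cls_const[OF assms])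
    fix r
    assume "r \<in> cls p"
    then have "r \<in> carrier F" "nc_const c * (r - p) \<in> I"
      using mem_cls[OF assms] I_mult by auto
    then show "cls (nc_const c * r) = cls (nc_const c * p)"
      using assms by (simp add: cls_eq_iff algebra_simps)
  qed
  finally show ?thesis .
qed

lemma presented_zero: "\<zero>\<^bsub>A\<^esub> = cls 0"
  using a_rcos_zero[OF ideal_axioms, of 0] additive_subgroup.zero_closed[OF is_additive_subgroup]
  by (simp add: presented_algebra_def Let_def ring.defs module.defs FactRing_def)

lemma ring_presented: "ring A"
proof (rule ringI)
  show "abelian_group A"
  proof (rule abelian_groupI)
    fix u
    assume "u \<in> carrier A"
    then obtain p where "p \<in> carrier F" "u = cls p"
      by (auto simp: carrier_presented)
    then show "\<exists>v\<in>carrier A. v \<oplus>\<^bsub>A\<^esub> u = \<zero>\<^bsub>A\<^esub>"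
      by (intro bexI[of _ "cls (- p)"]) (simp_all add: presented_add presented_zero cls_closed)
  qed (auto simp: carrier_presented presented_add presented_zero add_ac)
  show "Group.monoid A"
    by (rule monoidI) (auto simp: carrier_presented presented_mult presented_one mult.assoc)
qed (auto simp: carrier_presented presented_add presented_mult distrib_left distrib_right)

lemma assoc_algebra_presented: "assoc_algebra complex_field A"
proof -
  interpret A: ring A
    by (rule ring_presented)
  have "module complex_field A"
    by (rule moduleI[OF cring_from_type_algebra A.abelian_group_axioms])
      (auto simp: carrier_presented presented_smult presented_add ring_of_type_algebra_def
        nc_const_add nc_const_mult algebra_simps)
  then show ?thesis
    by (intro assoc_algebra.intro assoc_algebra_axioms.intro ring_presented)
      (auto simp: carrier_presented presented_smult presented_mult mult.assoc nc_const_left_commute)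
qed

lemma presented_minus:
  assumes "p \<in> carrier F" "r \<in> carrier F"
  shows "cls p \<ominus>\<^bsub>A\<^esub> cls r = cls (p - r)"
proof -
  interpret A: ring A
    by (rule ring_presented)
  have "cls (p - r) \<oplus>\<^bsub>A\<^esub> cls r = cls p"
    using assms by (simp add: presented_add)
  then have "cls p = cls (p - r) \<oplus>\<^bsub>A\<^esub> cls r"
    by (rule sym)
  then show ?thesis
    using A.add.inv_solve_right[of "cls (p - r)" "cls p" "cls r"] assms
    by (simp add: A.minus_eq cls_closed)
qed

text \<open>The universal property of a presentation: a substitution sending the relations into the
  target ideal descends to the quotients.\<close>

lemma presented_hom:
  assumes "presentation S' Rels'"
    and f: "\<And>x. x \<in> S \<Longrightarrow> f x \<in> carrier (free_algebra S')"
    and rels: "\<And>r. r \<in> Rels \<Longrightarrow> nc_subst f r \<in> Idl\<^bsub>free_algebra S'\<^esub> Rels'"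
  obtains \<pi> where "\<pi> \<in> algebra_hom complex_field A (presented_algebra S' Rels')"
    and "\<And>p. p \<in> carrier F \<Longrightarrow>
      \<pi> (cls p) = Idl\<^bsub>free_algebra S'\<^esub> Rels' +>\<^bsub>free_algebra S'\<^esub> nc_subst f p"
proof -
  interpret B: presentation S' Rels'
    by fact
  note closed = nc_subst_closed[OF _ f]
  interpret hom: ring_hom_ring F B.F "nc_subst f"
    by (rule ring_hom_ringI2[OF ring_free_algebra ring_free_algebra nc_subst_ring_hom[OF f]])
  \<comment> \<open>The preimage of the target ideal is an ideal containing \<open>Rels\<close>,
    hence contains \<open>I\<close> by minimality.\<close>
  have "ideal {p \<in> carrier F. nc_subst f p \<in> B.I} F"
    by (rule hom.ideal_vimage[OF B.ideal_axioms])
  then have I: "nc_subst f p \<in> B.I" if "p \<in> I" for p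
    using genideal_minimal[of _ Rels] rels Rels_closed that by blast
  define \<pi> where "\<pi> U = (\<Union>p\<in>U. B.cls (nc_subst f p))" for U
  have \<pi>: "\<pi> (cls p) = B.cls (nc_subst f p)" if "p \<in> carrier F" for p
    unfolding \<pi>_def
  proof (rule UN_cls_const[OF that])
    fix r
    assume "r \<in> cls p"
    with mem_cls[OF that this] show "B.cls (nc_subst f r) = B.cls (nc_subst f p)"
      using I[of "r - p"] that by (simp add: B.cls_eq_iff closed)
  qed
  have "\<pi> \<in> ring_hom A B.A"
    by (rule ring_hom_memI)
      (auto simp: carrier_presented B.carrier_presented \<pi> closed presented_mult presented_add
        presented_one B.presented_mult B.presented_add B.presented_one)
  then have "\<pi> \<in> algebra_hom complex_field A B.A"
    unfolding algebra_hom_def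
    by (auto simp: assoc_algebra_presented B.assoc_algebra_presented carrier_presented \<pi> closed
        presented_smult B.presented_smult)
  then show ?thesis
    using \<pi> that by blast
qed

text \<open>Modulo the relation, \<open>x\<close> times \<open>u + v - x\<close> equals
  \<open>u v\<close>, in either order. The scalar \<open>t\<close> is the inverse of
  \<open>u v\<close>.\<close>

lemma cls_quadratic_Units:
  assumes x: "x \<in> carrier F" and quad: "(x - nc_const u) * (x - nc_const v) \<in> I"
    and t: "t * (u * v) = 1"
  shows "cls x \<in> Units A"
    and "inv\<^bsub>A\<^esub> cls x = cls (nc_const (t * (u + v)) - nc_const t * x)"
proof -
  interpret A: ring A
    by (rule ring_presented)
  let ?y = "nc_const (t * (u + v)) - nc_const t * x"
  have "x * ?y = nc_const (t * (u * v)) - nc_const t * ((x - nc_const u) * (x - nc_const v))"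
    and "?y * x = nc_const (t * (u * v)) - nc_const t * ((x - nc_const u) * (x - nc_const v))"
    by (simp_all add: nc_const_commute[of x] nc_const_left_commute[of x] nc_expand algebra_simps)
  then have "x * ?y - 1 = - nc_const t * ((x - nc_const u) * (x - nc_const v))"
    and "?y * x - 1 = - nc_const t * ((x - nc_const u) * (x - nc_const v))"
    by (simp_all add: t)
  then have "x * ?y - 1 \<in> I" "?y * x - 1 \<in> I"
    using I_mult(1)[OF _ quad, of "- nc_const t"] by simp_all
  then have inv: "cls x \<otimes>\<^bsub>A\<^esub> cls ?y = \<one>\<^bsub>A\<^esub>" "cls ?y \<otimes>\<^bsub>A\<^esub> cls x = \<one>\<^bsub>A\<^esub>"
    using x by (simp_all add: presented_mult presented_one cls_eq_iff)
  then show unit: "cls x \<in> Units A"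
    using x by (auto simp: Units_def intro!: cls_closed bexI[of _ "cls ?y"])
  show "inv\<^bsub>A\<^esub> cls x = cls ?y"
    using x unit by (intro A.inv_unique[OF A.Units_l_inv inv(1)]) (auto intro: cls_closed)
qed

end


section \<open>Hecke relations for affine combinations of Temperley-Lieb generators\<close>

text \<open>
  In each identity the last summands have scalar coefficients that cancel for the parameters of
  the theorem; the other summands lie in the ideal of Temperley-Lieb relations.
\<close>

lemma affine_quadratic:
  fixes e :: "'x nc_poly"
  assumes "e = nc_var x" "p = nc_const a + nc_const b * e"
  shows "(p - nc_const a) * (p - nc_const v) =
      nc_const (b * b) * (e * e - nc_const s * e) + nc_const (b * (a - v + b * s)) * e"
    and "(p - nc_const v) * (p - nc_const a) =
      nc_const (b * b) * (e * e - nc_const s * e) + nc_const (b * (a - v + b * s)) * e"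
  unfolding assms
  by (simp_all add: nc_const_commute[of "nc_var _"] nc_const_left_commute[of "nc_var _"] nc_expand
      algebra_simps)

lemma affine_braid3:
  fixes e f :: "'x nc_poly"
  assumes "e = nc_var x" "f = nc_var y"
  shows "(nc_const a + e) * (nc_const a + f) * (nc_const a + e)
    - (nc_const a + f) * (nc_const a + e) * (nc_const a + f) =
    (e * f * e - e) - (f * e * f - f)
    + nc_const a * (e * e - nc_const d * e) - nc_const a * (f * f - nc_const d * f)
    + nc_const (1 + a * d + a * a) * (e - f)"
  unfolding assms
  by (simp add: nc_const_commute[of "nc_var _"] nc_const_left_commute[of "nc_var _"] nc_expand
      algebra_simps)

text \<open>Here \<open>f\<close> is a boundary generator and \<open>e\<close> its neighbour. The
  words \<open>f e f e\<close> and \<open>e f e f\<close> are both reduced through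
  \<open>e f e = e\<close>, and everything combines into commutators, leaving multiples of
  \<open>f e - e f\<close>.\<close>

lemma affine_braid4:
  fixes e f :: "'x nc_poly"
  assumes "e = nc_var x" "f = nc_var y" "p = nc_const a + nc_const b * f" "r = nc_const c + e"
  shows "p * r * p * r - r * p * r * p =
    nc_const (a * b) * (f * (e * e - nc_const d * e) - (e * e - nc_const d * e) * f)
    + nc_const (b * b * c) * ((f * f - nc_const s * f) * e - e * (f * f - nc_const s * f))
    + nc_const (b * b) * (f * (e * f * e - e) - (e * f * e - e) * f)
    + nc_const (a * b * c) * (f * e - e * f)
    + nc_const (b * (a * c + a * d + b * c * s + b)) * (f * e - e * f)"
  unfolding assms
  by (simp add: nc_const_commute[of "nc_var _"] nc_const_left_commute[of "nc_var _"] nc_expand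
      algebra_simps)

lemma affine_commute:
  fixes e f :: "'x nc_poly"
  assumes "e = nc_var x" "f = nc_var y"
  shows "(nc_const a + nc_const b * e) * (nc_const c + nc_const d * f)
    - (nc_const c + nc_const d * f) * (nc_const a + nc_const b * e)
    = nc_const (b * d) * (e * f - f * e)"
  unfolding assms
  by (simp add: nc_const_commute[of "nc_var _"] nc_const_left_commute[of "nc_var _"] nc_expand
      algebra_simps)

section \<open>Hecke relations modulo the Temperley-Lieb ideal\<close>

context presentation
begin

text \<open>Since \<open>e\<close> satisfies \<open>e e = s e\<close>, its possible eigenvalues are
  0 and \<open>s\<close>, giving \<open>p\<close> the values \<open>a\<close> and
  \<open>a + b s\<close>; the last hypothesis says that the latter is \<open>v\<close>. The constant
  term \<open>a\<close> is the first root listed at the boundary and the second one in the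
  bulk.\<close>

lemma quadratic_in_I:
  assumes "e = nc_var x" "e \<in> carrier F" "p = nc_const a + nc_const b * e"
    and "e * e - nc_const s * e \<in> I" and "a - v + b * s = 0"
  shows "(p - nc_const a) * (p - nc_const v) \<in> I" "(p - nc_const v) * (p - nc_const a) \<in> I"
  using assms(2,4) unfolding affine_quadratic[OF assms(1,3), of v s] assms(5)
  by (simp_all add: I_mult)

text \<open>For \<open>d = q + inverse q\<close> the condition on \<open>a\<close> factors as
  \<open>(a + q) (a + inverse q) = 0\<close>, which explains the constant \<open>- inverse q\<close>
  in the theorem.\<close>

lemma braid3_in_I:
  assumes "e = nc_var x" "f = nc_var y" "e \<in> carrier F" "f \<in> carrier F"
    and "e * f * e - e \<in> I" "f * e * f - f \<in> I"
    and "e * e - nc_const d * e \<in> I" "f * f - nc_const d * f \<in> I"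
    and "1 + a * d + a * a = 0"
  shows "(nc_const a + e) * (nc_const a + f) * (nc_const a + e)
    - (nc_const a + f) * (nc_const a + e) * (nc_const a + f) \<in> I"
  using assms(3-8) unfolding affine_braid3[OF assms(1,2), of a d] assms(9)
  by (simp add: I_mult I_add I_diff)

text \<open>The scalar condition, multiplied by \<open>b\<close>, is the vanishing of the total
  coefficient of \<open>f e - e f\<close> in \<open>affine_braid4\<close>.\<close>

lemma braid4_in_I:
  assumes "e = nc_var x" "f = nc_var y" "e \<in> carrier F" "f \<in> carrier F"
    and "p = nc_const a + nc_const b * f" "r = nc_const c + e"
    and "e * e - nc_const d * e \<in> I" "f * f - nc_const s * f \<in> I" "e * f * e - e \<in> I"
    and "a * c + (a * c + a * d + b * c * s + b) = 0"
  shows "p * r * p * r - r * p * r * p \<in> I" "r * p * r * p - p * r * p * r \<in> I"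
proof -
  \<comment> \<open>The two commutator coefficients are shown to be opposite, so that the last two
    summands cancel.\<close>
  have "a * c + a * d + b * c * s + b = - (a * c)"
    using assms(10) by (simp only: add_eq_0_iff)
  then have "b * (a * c + a * d + b * c * s + b) = b * - (a * c)"
    by (rule arg_cong)
  then have "b * (a * c + a * d + b * c * s + b) = - (a * b * c)"
    by (simp only: mult_minus_right mult.assoc mult.left_commute)
  then show "p * r * p * r - r * p * r * p \<in> I"
    using assms(3,4,7-9) unfolding affine_braid4[OF assms(1,2,5,6), of d s]
    by (simp add: I_mult I_add I_diff nc_const_uminus)
  from I_mult(1)[OF _ this, of "nc_const (- 1)"] show "r * p * r * p - p * r * p * r \<in> I"
    by (simp add: nc_const_uminus)
qed

lemma commute_in_I:
  assumes "e = nc_var x" "f = nc_var y" "e * f - f * e \<in> I"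
    and "p = nc_const a + nc_const b * e" "r = nc_const c + nc_const d * f"
  shows "p * r - r * p \<in> I"
  using assms(3) unfolding assms(4,5) affine_commute[OF assms(1,2)] by (simp add: I_mult)

end

theorem proposition2p13:
  fixes N :: nat and q qw1 qw2 \<delta> s1 s2 :: complex
  assumes "N \<ge> 2"
    and "q \<noteq> 0" "qw1 \<noteq> 0" "qw2 \<noteq> 0" "q^2 \<noteq> 1"
    and "qnum q (q * qw1) \<noteq> 0" "qnum q (q * qw2) \<noteq> 0"
    and "\<delta> = qnum q (q^2)"
    and "s1 = qnum q qw1 / qnum q (q * qw1)"
    and "s2 = qnum q qw2 / qnum q (q * qw2)"
  shows "let H = hecke_C N q qw1 qw2; g = hecke_C_gen N q qw1 qw2;
             T = two_boundary_TL N \<delta> s1 s2; e = two_boundary_TL_gen N \<delta> s1 s2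
    in (\<forall>i\<in>{0..N}. g i \<in> Units H) \<and>
       (\<exists>\<pi> \<in> algebra_hom complex_field H T.
          \<pi> ` carrier H = carrier T \<and>
          (\<forall>i\<in>{1..N-1}.
             \<pi> (g i) = e i \<ominus>\<^bsub>T\<^esub> inverse q \<odot>\<^bsub>T\<^esub> \<one>\<^bsub>T\<^esub> \<and>
             \<pi> (inv\<^bsub>H\<^esub> g i) = e i \<ominus>\<^bsub>T\<^esub> q \<odot>\<^bsub>T\<^esub> \<one>\<^bsub>T\<^esub>) \<and>
          \<pi> (g 0) = qw1 \<odot>\<^bsub>T\<^esub> \<one>\<^bsub>T\<^esub> \<ominus>\<^bsub>T\<^esub> (q * qw1 - inverse (q * qw1)) \<odot>\<^bsub>T\<^esub> e 0 \<and>
          \<pi> (inv\<^bsub>H\<^esub> g 0) =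
             inverse qw1 \<odot>\<^bsub>T\<^esub> \<one>\<^bsub>T\<^esub> \<ominus>\<^bsub>T\<^esub> (inverse (q * qw1) - q * qw1) \<odot>\<^bsub>T\<^esub> e 0 \<and>
          \<pi> (g N) = qw2 \<odot>\<^bsub>T\<^esub> \<one>\<^bsub>T\<^esub> \<ominus>\<^bsub>T\<^esub> (q * qw2 - inverse (q * qw2)) \<odot>\<^bsub>T\<^esub> e N \<and>
          \<pi> (inv\<^bsub>H\<^esub> g N) =
             inverse qw2 \<odot>\<^bsub>T\<^esub> \<one>\<^bsub>T\<^esub> \<ominus>\<^bsub>T\<^esub> (inverse (q * qw2) - q * qw2) \<odot>\<^bsub>T\<^esub> e N)"
proof -
  let ?S = "{0..N}"
  interpret H: presentation ?S "hecke_C_rels N q qw1 qw2"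
    using assms(1) by unfold_locales (auto simp: hecke_C_rels_def Let_def)
  interpret T: presentation ?S "two_boundary_TL_rels N \<delta> s1 s2"
    using assms(1) by unfold_locales (auto simp: two_boundary_TL_rels_def Let_def)
  define e :: "nat \<Rightarrow> nat nc_poly" where "e = nc_var"
  have e: "e i = nc_var i" "i \<le> N \<Longrightarrow> e i \<in> carrier T.F" for i
    by (simp_all add: e_def)
  have TL_e: "e i * e i - nc_const \<delta> * e i \<in> T.I" "e i * e (i + 1) * e i - e i \<in> T.I"
      "e i * e (i - 1) * e i - e i \<in> T.I" if "1 \<le> i" "i + 1 \<le> N" for i
    using that unfolding e_def by (intro T.Rels_I; unfold two_boundary_TL_rels_def Let_def; blast)+
  have TL_0: "e 0 * e 0 - nc_const s1 * e 0 \<in> T.I"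
    and TL_N: "e N * e N - nc_const s2 * e N \<in> T.I"
    unfolding e_def by (intro T.Rels_I; unfold two_boundary_TL_rels_def Let_def; blast)+
  have TL_commute: "e i * e j - e j * e i \<in> T.I"
    if "i \<le> N" "j \<le> N" "\<bar>int i - int j\<bar> > 1" for i j
    using that unfolding e_def by (intro T.Rels_I; unfold two_boundary_TL_rels_def Let_def; blast)

  \<comment> \<open>Scalar identities for the parameters\<close>
  define a1 a2 where "a1 = q * qw1 - inverse (q * qw1)" and "a2 = q * qw2 - inverse (q * qw2)"
  have D: "q - inverse q \<noteq> 0"
  proof
    assume "q - inverse q = 0"
    then have "q * q = q * inverse q"
      by simp
    then show False
      using assms(2,5) by (simp add: power2_eq_square)
  qed
  have \<delta>: "\<delta> = q + inverse q"
  proof -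
    have "q^2 - inverse (q^2) = (q + inverse q) * (q - inverse q)"
      by (simp add: power2_eq_square algebra_simps)
    then show ?thesis
      using D by (simp add: assms(8) qnum_def)
  qed
  have a: "a1 \<noteq> 0" "a2 \<noteq> 0"
    using assms(6,7) by (auto simp: qnum_def a1_def a2_def)
  \<comment> \<open>The denominators \<open>q - inverse q\<close> cancel. Thus
    \<open>qw1 - a1 * s1\<close> is the other root \<open>inverse qw1\<close> of the quadratic
    relation, and likewise at the other end.\<close>
  have s: "a1 * s1 = qw1 - inverse qw1" "a2 * s2 = qw2 - inverse qw2"
    unfolding assms(9,10) qnum_def a1_def[symmetric] a2_def[symmetric] using D a by simp_all
  \<comment> \<open>The conditions of \<open>quadratic_in_I\<close> and \<open>braid3_in_I\<close>
    for \<open>a = - inverse q\<close>; the factor 1 is the coefficient of the generator.\<close>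
  have mid_quad: "- inverse q - q + 1 * \<delta> = 0"
    and mid_braid: "1 + - inverse q * \<delta> + - inverse q * - inverse q = 0"
    using assms(2) by (simp_all add: \<delta> algebra_simps)
  \<comment> \<open>The condition of \<open>braid4_in_I\<close> for the boundary image
    \<open>w - b f\<close> and the bulk image \<open>- inverse q + e\<close>, treated once for both
    ends.\<close>
  have boundary_braid: "w * - inverse q + (w * - inverse q + w * \<delta> + - b * - inverse q * s + - b) = 0"
    if "w \<noteq> 0" "b * s = w - inverse w" "b = q * w - inverse (q * w)" for w b s
  proof -
    have "- b * - inverse q * s = inverse q * (w - inverse w)"
      unfolding that(2)[symmetric] by simp
    then show ?thesis
      using assms(2) that(1) by (simp add: that(3) \<delta> algebra_simps)
  qed

  \<comment> \<open>The prescribed images, in one affine form so that commutation of distant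
    generators needs no case distinction.\<close>
  define f where "f i = nc_const (if i = 0 then qw1 else if i = N then qw2 else - inverse q)
    + nc_const (if i = 0 then - a1 else if i = N then - a2 else 1) * e i" for i
  have f_0: "f 0 = nc_const qw1 + nc_const (- a1) * e 0"
    and f_N: "f N = nc_const qw2 + nc_const (- a2) * e N"
    using assms(1) by (simp_all add: f_def)
  have f_mid: "f i = nc_const (- inverse q) + e i" if "1 \<le> i" "i + 1 \<le> N" for i
    using that by (simp add: f_def)
  \<comment> \<open>At the ends the slope is nonzero because \<open>[\<omega>\<^sub>1 + 1]\<close>
    and \<open>[\<omega>\<^sub>2 + 1]\<close> are; this makes the substitution invertible.\<close>
  have f_affine: "\<exists>a b. f i = nc_const a + nc_const b * e i \<and> b \<noteq> 0" for i
    unfolding f_def by (rule exI, rule exI, rule conjI, rule refl) (use a in simp)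
  have f_closed: "f i \<in> carrier T.F" if "i \<in> ?S" for i
    using that by (simp add: f_def e)

  \<comment> \<open>The images satisfy the Hecke relations\<close>
  have quad_0: "(f 0 - nc_const qw1) * (f 0 - nc_const (inverse qw1)) \<in> T.I"
    using s by (intro T.quadratic_in_I[OF e(1) _ f_0 TL_0]) (simp_all add: e)
  have quad_N: "(f N - nc_const qw2) * (f N - nc_const (inverse qw2)) \<in> T.I"
    using s by (intro T.quadratic_in_I[OF e(1) _ f_N TL_N]) (simp_all add: e)
  have quad_mid: "(f i - nc_const q) * (f i + nc_const (inverse q)) \<in> T.I"
    if "1 \<le> i" "i + 1 \<le> N" for i
    using T.quadratic_in_I(2)[OF e(1) _ _ TL_e(1) mid_quad, of i "f i"] that
    by (simp add: f_mid e nc_const_uminus)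
  have braid_mid: "f i * f (i + 1) * f i - f (i + 1) * f i * f (i + 1) \<in> T.I"
    if "1 \<le> i" "i + 2 \<le> N" for i
    using T.braid3_in_I[OF e(1) e(1) _ _ _ _ _ _ mid_braid, of i "i + 1"] that
      TL_e[of i] TL_e[of "i + 1"] by (simp add: f_mid e)
  \<comment> \<open>The bulk relation needed is the one with the boundary generator in the middle:
    at 1 with its left neighbour here, at \<open>N - 1\<close> with its right neighbour
    below.\<close>
  have braid_0: "f 0 * f 1 * f 0 * f 1 - f 1 * f 0 * f 1 * f 0 \<in> T.I"
    using assms(1) TL_e[of 1] TL_0
    by (intro T.braid4_in_I(1)[OF e(1) e(1) _ _ f_0 f_mid _ _ _
          boundary_braid[OF assms(3) s(1) a1_def]]) (simp_all add: e)
  have braid_N: "f N * f (N - 1) * f N * f (N - 1) - f (N - 1) * f N * f (N - 1) * f N \<in> T.I"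
    using assms(1) TL_e[of "N - 1"] TL_N
    by (intro T.braid4_in_I(1)[OF e(1) e(1) _ _ f_N f_mid _ _ _
          boundary_braid[OF assms(4) s(2) a2_def]]) (simp_all add: e)
  have commute: "f i * f j - f j * f i \<in> T.I" if "i \<le> N" "j \<le> N" "\<bar>int i - int j\<bar> > 1" for i j
    using f_affine[of i] f_affine[of j] T.commute_in_I[OF e(1) e(1) TL_commute[OF that]] by blast
  have rels: "nc_subst f r \<in> T.I" if "r \<in> hecke_C_rels N q qw1 qw2" for r
    using that unfolding hecke_C_rels_def Let_def
    by (elim UnE CollectE exE conjE singletonE)
      (simp_all add: quad_0 quad_N quad_mid braid_mid[simplified] braid_0[simplified]
        braid_N[simplified] commute)
  obtain \<pi> where \<pi>: "\<pi> \<in> algebra_hom complex_field H.A T.A"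
    and \<pi>_cls: "\<And>p. p \<in> carrier H.F \<Longrightarrow> \<pi> (H.cls p) = T.cls (nc_subst f p)"
    by (rule H.presented_hom[where f = f, OF T.presentation_axioms f_closed rels]) blast+

  \<comment> \<open>Surjectivity\<close>
  have "\<exists>p. nc_subst f p = e i \<and> p \<in> carrier H.F" if "i \<in> ?S" for i
  proof -
    obtain a b where "f i = nc_const a + nc_const b * e i" "b \<noteq> 0"
      using f_affine by blast
    then show ?thesis
      using that
      \<comment> \<open>The witness solves \<open>f i = a + b e i\<close> for
        \<open>e i\<close>.\<close>
      by (intro exI[of _ "nc_const (inverse b) * (nc_var i - nc_const a)"])
        (simp add: nc_const_mult_assoc)
  qed
  then obtain h where h: "\<And>i. i \<in> ?S \<Longrightarrow> nc_subst f (h i) = nc_var i"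
      "\<And>i. i \<in> ?S \<Longrightarrow> h i \<in> carrier H.F"
    unfolding e_def by metis
  have surj: "\<pi> ` carrier H.A = carrier T.A"
  proof
    show "\<pi> ` carrier H.A \<subseteq> carrier T.A"
      using \<pi> by (auto simp: algebra_hom_def ring_hom_def)
    show "carrier T.A \<subseteq> \<pi> ` carrier H.A"
    proof
      fix v
      assume "v \<in> carrier T.A"
      then obtain p where p: "p \<in> carrier T.F" "v = T.cls p"
        by (auto simp: T.carrier_presented)
      \<comment> \<open>Substituting \<open>h\<close> and then \<open>f\<close> returns
        \<open>p\<close>, so the class of \<open>nc_subst h p\<close> is a preimage of
        \<open>v\<close>.\<close>
      have "nc_subst h p \<in> carrier H.F"
        using nc_subst_closed[OF p(1) h(2)] .
      moreover have "v = \<pi> (H.cls (nc_subst h p))"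
        using \<pi>_cls[OF calculation] nc_subst_nc_subst_id[OF p(1) h(1)] p(2) by simp
      ultimately show "v \<in> \<pi> ` carrier H.A"
        by (auto intro: H.cls_closed)
    qed
  qed

  \<comment> \<open>Inverses of the Hecke generators and their images\<close>
  have H_0: "(nc_var 0 - nc_const qw1) * (nc_var 0 - nc_const (inverse qw1)) \<in> H.I"
    and H_N: "(nc_var N - nc_const qw2) * (nc_var N - nc_const (inverse qw2)) \<in> H.I"
    by (intro H.Rels_I; unfold hecke_C_rels_def Let_def; blast)+
  have H_mid: "(nc_var i - nc_const q) * (nc_var i - nc_const (- inverse q)) \<in> H.I"
    if "1 \<le> i" "i + 1 \<le> N" for i
    using that unfolding nc_const_uminus diff_minus_eq_add
    by (intro H.Rels_I; unfold hecke_C_rels_def Let_def; blast)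
  \<comment> \<open>The product of the roots is 1 at the boundary and
    \<open>q * - inverse q = - 1\<close> in the bulk, whence the values of \<open>t\<close>.\<close>
  note inv_0 = H.cls_quadratic_Units[OF _ H_0, of 1]
    and inv_N = H.cls_quadratic_Units[OF _ H_N, of 1]
    and inv_mid = H.cls_quadratic_Units[OF _ H_mid, of _ "- 1"]
  have units: "H.cls (nc_var i) \<in> Units H.A" if i: "i \<in> ?S" for i
  proof -
    consider "i = 0" | "i = N" | "1 \<le> i" "i + 1 \<le> N"
      using i by force
    then show ?thesis
      using inv_0(1) inv_N(1) inv_mid(1) assms(2-4) by cases simp_all
  qed
  have mid: "\<pi> (H.cls (nc_var i)) = T.cls (nc_var i) \<ominus>\<^bsub>T.A\<^esub> inverse q \<odot>\<^bsub>T.A\<^esub> \<one>\<^bsub>T.A\<^esub>"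
      "\<pi> (inv\<^bsub>H.A\<^esub> H.cls (nc_var i)) = T.cls (nc_var i) \<ominus>\<^bsub>T.A\<^esub> q \<odot>\<^bsub>T.A\<^esub> \<one>\<^bsub>T.A\<^esub>"
    if "i \<in> {1..N - 1}" for i
  proof -
    have i: "1 \<le> i" "i + 1 \<le> N"
      using that assms(1) by auto
    then show "\<pi> (H.cls (nc_var i)) = T.cls (nc_var i) \<ominus>\<^bsub>T.A\<^esub> inverse q \<odot>\<^bsub>T.A\<^esub> \<one>\<^bsub>T.A\<^esub>"
      by (simp add: \<pi>_cls f_mid e T.presented_one T.presented_smult T.presented_minus nc_const_uminus)
    \<comment> \<open>The inverse is the generator minus \<open>q - inverse q\<close>, which turns
      the constant \<open>- inverse q\<close> of its image into \<open>- q\<close>.\<close>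
    show "\<pi> (inv\<^bsub>H.A\<^esub> H.cls (nc_var i)) = T.cls (nc_var i) \<ominus>\<^bsub>T.A\<^esub> q \<odot>\<^bsub>T.A\<^esub> \<one>\<^bsub>T.A\<^esub>"
      using i assms(2) inv_mid(2)[OF _ i]
      by (simp add: \<pi>_cls f_mid e T.presented_one T.presented_smult T.presented_minus nc_const_uminus
          nc_const_add nc_const_diff)
  qed
  \<comment> \<open>A boundary inverse is the sum of the two roots minus the generator, so the
    constant becomes the other root and the coefficient of the Temperley-Lieb generator changes
    sign.\<close>
  have bdry: "\<pi> (H.cls (nc_var 0)) =
        qw1 \<odot>\<^bsub>T.A\<^esub> \<one>\<^bsub>T.A\<^esub> \<ominus>\<^bsub>T.A\<^esub> (q * qw1 - inverse (q * qw1)) \<odot>\<^bsub>T.A\<^esub> T.cls (nc_var 0)"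
      "\<pi> (inv\<^bsub>H.A\<^esub> H.cls (nc_var 0)) =
        inverse qw1 \<odot>\<^bsub>T.A\<^esub> \<one>\<^bsub>T.A\<^esub> \<ominus>\<^bsub>T.A\<^esub> (inverse (q * qw1) - q * qw1) \<odot>\<^bsub>T.A\<^esub> T.cls (nc_var 0)"
      "\<pi> (H.cls (nc_var N)) =
        qw2 \<odot>\<^bsub>T.A\<^esub> \<one>\<^bsub>T.A\<^esub> \<ominus>\<^bsub>T.A\<^esub> (q * qw2 - inverse (q * qw2)) \<odot>\<^bsub>T.A\<^esub> T.cls (nc_var N)"
      "\<pi> (inv\<^bsub>H.A\<^esub> H.cls (nc_var N)) =
        inverse qw2 \<odot>\<^bsub>T.A\<^esub> \<one>\<^bsub>T.A\<^esub> \<ominus>\<^bsub>T.A\<^esub> (inverse (q * qw2) - q * qw2) \<odot>\<^bsub>T.A\<^esub> T.cls (nc_var N)"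
    using assms(3,4) inv_0(2) inv_N(2)
    by (simp_all add: \<pi>_cls f_0 f_N e a1_def a2_def T.presented_one T.presented_smult
        T.presented_minus nc_const_uminus nc_const_add nc_const_diff algebra_simps)
  show ?thesis
    unfolding Let_def hecke_C_def hecke_C_gen_def two_boundary_TL_def two_boundary_TL_gen_def
      presented_gen_def
    using units surj mid bdry by (intro conjI ballI bexI[OF _ \<pi>]) blast+
qed

end
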